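(* Let $a,b\ge 1$ and $n\ge 2$ be integers. The vertex set of the Horadam cube $\Pi^{a,b}_n$ is the disjoint union of the $a$ sets $k\mathcal S^{a,b}_{n-1}=\{k\alpha:\alpha\in\mathcal S^{a,b}_{n-1}\}$, $0\le k\le a-1$, and the $b$ sets $0l\,\mathcal S^{a,b}_{n-2}=\{0l\beta:\beta\in\mathcal S^{a,b}_{n-2}\}$, $a\le l\le a+b-1$. Each of the first $a$ sets induces a subgraph of $\Pi^{a,b}_n$ isomorphic to $\Pi^{a,b}_{n-1}$, and each of the last $b$ sets induces a subgraph isomorphic to $\Pi^{a,b}_{n-2}$. Moreover, the subgraph of $\Pi^{a,b}_n$ induced by $\bigcup_{k=0}^{a-1}k\mathcal S^{a,b}_{n-1}$ is isomorphic to $P_a\square\Pi^{a,b}_{n-1}$, and the subgraph induced by $\bigcup_{l=a}^{a+b-1}0l\,\mathcal S^{a,b}_{n-2}$ is isomorphic to $P_b\square\Pi^{a,b}_{n-2}$. (In the notation $G=H_1\oplus\cdots\oplus H_m$ for such a partition of the vertex set of $G$ into parts inducing $H_1,\dots,H_m$: $\Pi^{a,b}_n=\Pi^{a,b}_{n-1}\oplus\cdots\oplus\Pi^{a,b}_{n-1}\oplus\Pi^{a,b}_{n-2}\oplus\cdots\oplus\Pi^{a,b}_{n-2}=P_a\square\Pi^{a,b}_{n-1}\oplus P_b\square\Pi^{a,b}_{n-2}$, with $a$ copies of $\Pi^{a,b}_{n-1}$ and $b$ copies of $\Pi^{a,b}_{n-2}$.)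
   Context: For integers $a,b\ge1$ and $n\ge 0$, $\mathcal S^{a,b}_n$ is the set of all strings of length $n$ over the alphabet $\{0,1,\dots,a+b-1\}$ in which every letter from $\{a,a+1,\dots,a+b-1\}$ appears only immediately after a letter $0$ (other letters appear arbitrarily); $\mathcal S^{a,b}_0$ contains only the empty string. The Horadam cube $\Pi^{a,b}_n$ is the simple graph with vertex set $\mathcal S^{a,b}_n$ in which $x_1\cdots x_n$ and $y_1\cdots y_n$ are adjacent if and only if $\sum_{i=1}^n|x_i-y_i|=1$. $P_m$ denotes the path graph with $m$ vertices. $G\square H$ denotes the Cartesian product of graphs: vertex set $V(G)\times V(H)$, with $(u_1,v_1)$ and $(u_2,v_2)$ adjacent if $u_1=u_2$ and $v_1v_2\in E(H)$, or $v_1=v_2$ and $u_1u_2\in E(G)$. Juxtaposition of strings denotes concatenation. *)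

theory Defs
  imports "Graph_Theory.Graph_Theory" "HOL-Library.Disjoint_Sets"
begin

text \<open>
  Simple graphs are rendered as in the session Graph_Theory: as symmetric loop-free digraphs whose
  arcs are pairs of vertices (locale \<^locale>\<open>pair_graph\<close>). An edge \<open>uv\<close> corresponds to the two arcs
  \<open>(u, v)\<close> and \<open>(v, u)\<close>, and \<^const>\<open>digraph_iso\<close> is then isomorphism of simple graphs.
\<close>

definition horadam_strings :: "nat \<Rightarrow> nat \<Rightarrow> nat \<Rightarrow> nat list set" where
  "horadam_strings a b n =
    {x. length x = n \<and> (\<forall>i<n. x ! i < a + b) \<and>
        (\<forall>i<n. a \<le> x ! i \<longrightarrow> 0 < i \<and> x ! (i - 1) = 0)}"

definition horadam_cube :: "nat \<Rightarrow> nat \<Rightarrow> nat \<Rightarrow> nat list pair_pre_digraph" where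
  "horadam_cube a b n =
    \<lparr> pverts = horadam_strings a b n,
      parcs = {(x, y). x \<in> horadam_strings a b n \<and> y \<in> horadam_strings a b n \<and>
                       (\<Sum>i<n. \<bar>int (x ! i) - int (y ! i)\<bar>) = 1} \<rparr>"

definition path_graph :: "nat \<Rightarrow> nat pair_pre_digraph" where
  "path_graph m =
    \<lparr> pverts = {..<m}, parcs = {(i, j). i < m \<and> j < m \<and> (j = Suc i \<or> i = Suc j)} \<rparr>"

definition cartesian_product ::
    "'a pair_pre_digraph \<Rightarrow> 'b pair_pre_digraph \<Rightarrow> ('a \<times> 'b) pair_pre_digraph"
    (infixr \<open>\<box>\<close> 70) where
  "G \<box> H =
    \<lparr> pverts = pverts G \<times> pverts H,
      parcs = {((u1, v1), (u2, v2)).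
                 (u1 = u2 \<and> u1 \<in> pverts G \<and> (v1, v2) \<in> parcs H) \<or>
                 (v1 = v2 \<and> v1 \<in> pverts H \<and> (u1, u2) \<in> parcs G)} \<rparr>"

text \<open>\<open>decomposes_into G [H\<^sub>1, \<dots>, H\<^sub>m]\<close> stands for \<open>G = H\<^sub>1 \<oplus> \<dots> \<oplus> H\<^sub>m\<close>.\<close>

definition decomposes_into :: "'a pair_pre_digraph \<Rightarrow> 'b pair_pre_digraph list \<Rightarrow> bool" where
  "decomposes_into G Hs \<longleftrightarrow>
    (\<exists>V :: nat \<Rightarrow> 'a set.
       disjoint_family_on V {..<length Hs} \<and>
       pverts G = (\<Union>i<length Hs. V i) \<and>
       (\<forall>i<length Hs. digraph_iso (with_proj G \<restriction> V i) (with_proj (Hs ! i))))"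

lemma finite_horadam_strings: "finite (horadam_strings a b n)"
proof (rule finite_subset)
  show "horadam_strings a b n \<subseteq> {x. set x \<subseteq> {..<a + b} \<and> length x = n}"
    by (auto simp: horadam_strings_def in_set_conv_nth)
  show "finite {x. set x \<subseteq> {..<a + b} \<and> length x = n}"
    by (rule finite_lists_length_eq) simp
qed

lemma pair_graphI:
  assumes "finite (pverts G)" and "parcs G \<subseteq> pverts G \<times> pverts G"
    and "\<And>u v. (u, v) \<in> parcs G \<Longrightarrow> (v, u) \<in> parcs G" and "\<And>u. (u, u) \<notin> parcs G"
  shows "pair_graph G"
proof -
  have "finite (parcs G)"
    using assms(1,2) by (meson finite_SigmaI finite_subset)
  with assms show ?thesis
    by unfold_locales (auto simp: symmetric_def intro: symI)
qed

lemma pair_graph_horadam_cube: "pair_graph (horadam_cube a b n)"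
  by (rule pair_graphI)
    (auto simp: horadam_cube_def finite_horadam_strings abs_minus_commute)

lemma pair_graph_path_graph: "pair_graph (path_graph m)"
  by (rule pair_graphI) (auto simp: path_graph_def)

lemma pair_graph_cartesian_product:
  assumes "pair_graph G" "pair_graph H"
  shows "pair_graph (G \<box> H)"
proof -
  interpret G: pair_graph G by fact
  interpret H: pair_graph H by fact
  have "\<And>u v. (u, v) \<in> parcs G \<Longrightarrow> (v, u) \<in> parcs G" "\<And>u v. (u, v) \<in> parcs H \<Longrightarrow> (v, u) \<in> parcs H"
    using G.pair_sym_arcs H.pair_sym_arcs by (auto simp: symmetric_def dest: symD)
  moreover have "\<And>u. (u, u) \<notin> parcs G" "\<And>u. (u, u) \<notin> parcs H"
    using G.pair_no_loops H.pair_no_loops by fastforce+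
  ultimately show ?thesis
    using G.pair_finite_verts H.pair_finite_verts
    by (intro pair_graphI)
      (auto simp: cartesian_product_def dest: G.in_arcsD1 G.in_arcsD2 H.in_arcsD1 H.in_arcsD2)
qed

end

theory Submission
  imports Defs
begin

text \<open>
  A Horadam string of length at least two either starts with a letter \<open>k < a\<close> followed by an
  arbitrary Horadam string, or starts with \<open>0l\<close> for some \<open>l \<ge> a\<close>; in the latter case the next letter
  cannot exceed \<open>a - 1\<close> because \<open>l \<noteq> 0\<close>. Changing the free letter by \<open>d\<close> contributes exactly \<open>d\<close> to
  the \<open>\<ell>\<^sub>1\<close>-distance, and a sum of two nonnegative integers equals 1 iff one of them is 1 and the
  other 0, which is the adjacency rule of a Cartesian product with a path.
\<close>

section \<open>Isomorphisms of induced subgraphs\<close>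

text \<open>A copy of \<open>H\<close> inside \<open>G\<close> is most easily given as an embedding
  \<open>g\<close>, whereas \<open>digraph_iso\<close> asks for a map from its first graph onto its
  second. The inverse of \<open>g\<close> serves, and since arcs are pairs it also determines the
  arc map.\<close>

lemma digraph_iso_induced_subgraphI:
  assumes G: "pair_graph G" and H: "pair_graph H"
    and bij: "bij_betw g (pverts H) S"
    and adj: "\<And>u v. u \<in> pverts H \<Longrightarrow> v \<in> pverts H \<Longrightarrow> (g u, g v) \<in> parcs G \<longleftrightarrow> (u, v) \<in> parcs H"
  shows "digraph_iso (with_proj G \<restriction> S) (with_proj H)"
proof -
  interpret G: pair_graph G by fact
  interpret H: pair_graph H by fact
  define f where "f = the_inv_into (pverts H) g"
  define hom where "hom = \<lparr>iso_verts = f, iso_arcs = map_prod f f, iso_head = snd, iso_tail = fst\<rparr>"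
  have inj: "inj_on g (pverts H)" and S: "S = g ` pverts H"
    using bij by (auto simp: bij_betw_def)
  have f_g: "f (g u) = u" if "u \<in> pverts H" for u
    using inj that by (simp add: f_def the_inv_into_f_f)
  \<comment> \<open>All of \<open>adj\<close> is spent here; what remains rests on cancelling
    \<open>f\<close> against \<open>g\<close>.\<close>
  have arcs: "arcs (with_proj G \<restriction> S) = map_prod g g ` parcs H"
  proof -
    have "(u, v) \<in> arcs (with_proj G \<restriction> S) \<longleftrightarrow> (u, v) \<in> map_prod g g ` parcs H" for u v
    proof
      assume "(u, v) \<in> arcs (with_proj G \<restriction> S)"
      then obtain x y where "u = g x" "v = g y" "(x, y) \<in> parcs H"
        using adj by (auto simp: S)
      then show "(u, v) \<in> map_prod g g ` parcs H" by force
    next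
      assume "(u, v) \<in> map_prod g g ` parcs H"
      then obtain x y where "u = g x" "v = g y" "(x, y) \<in> parcs H" by auto
      then show "(u, v) \<in> arcs (with_proj G \<restriction> S)"
        using adj[of x y] by (auto simp: S H.in_arcsD1 H.in_arcsD2)
    qed
    then show ?thesis
      by (intro set_eqI) (metis surj_pair)
  qed
  have "wf_digraph (with_proj G \<restriction> S)"
    by (rule G.wellformed_induce_subgraph)
  moreover have inj_f: "inj_on f S"
    by (auto simp: S f_g inj_on_def)
  moreover have "inj_on (map_prod f f) (map_prod g g ` parcs H)"
    by (rule inj_on_subset[OF map_prod_inj_on[OF inj_f inj_f]])
      (auto simp: S H.in_arcsD1 H.in_arcsD2)
  ultimately have "pre_digraph.digraph_isomorphism (with_proj G \<restriction> S) hom"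
    unfolding pre_digraph.digraph_isomorphism_def arcs by (simp add: hom_def)
  \<comment> \<open>\<open>digraph_iso\<close> demands that the image equal
    \<open>with_proj H\<close> as a record, hence the comparison field by field.\<close>
  moreover have "with_proj H = app_iso hom (with_proj G \<restriction> S)"
  proof (rule pre_digraph.equality)
    show "verts (with_proj H) = verts (app_iso hom (with_proj G \<restriction> S))"
      by (simp add: hom_def S image_image f_g)
    have "map_prod f f (map_prod g g e) = e" if "e \<in> parcs H" for e
      using that by (cases e) (simp add: f_g H.in_arcsD1 H.in_arcsD2)
    then show "arcs (with_proj H) = arcs (app_iso hom (with_proj G \<restriction> S))"
      by (simp add: arcs hom_def image_image del: induce_subgraph_arcs)
  qed (simp_all add: hom_def)
  ultimately show ?thesis
    unfolding digraph_iso_def by blast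
qed

section \<open>The l1-distance and adjacency in the cube\<close>

text \<open>The l1-distance of lists of equal length. Summing up to \<open>length x\<close> rather
  than a fixed \<open>n\<close> lets first letters be peeled off without tracking lengths.\<close>

definition list_dist :: "nat list \<Rightarrow> nat list \<Rightarrow> int" where
  "list_dist x y = (\<Sum>i<length x. \<bar>int (x ! i) - int (y ! i)\<bar>)"

lemma list_dist_Cons: "list_dist (k # x) (l # y) = \<bar>int k - int l\<bar> + list_dist x y"
  by (simp add: list_dist_def sum.lessThan_Suc_shift del: sum.lessThan_Suc)

lemma list_dist_nonneg: "list_dist x y \<ge> 0"
  by (simp add: list_dist_def sum_nonneg)

lemma list_dist_eq_0_iff: "length x = length y \<Longrightarrow> list_dist x y = 0 \<longleftrightarrow> x = y"
  by (auto simp: list_dist_def sum_nonneg_eq_0_iff list_eq_iff_nth_eq)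

lemma length_horadam_strings: "x \<in> horadam_strings a b n \<Longrightarrow> length x = n"
  by (simp add: horadam_strings_def)

lemma pverts_horadam_cube: "pverts (horadam_cube a b n) = horadam_strings a b n"
  by (simp add: horadam_cube_def)

lemma parcs_horadam_cube_iff:
  "(x, y) \<in> parcs (horadam_cube a b n) \<longleftrightarrow>
    x \<in> horadam_strings a b n \<and> y \<in> horadam_strings a b n \<and> list_dist x y = 1"
  by (auto simp: horadam_cube_def list_dist_def length_horadam_strings)

section \<open>Splitting off the first letters of Horadam strings\<close>

text \<open>A Horadam string never starts with a letter \<open>\<ge> a\<close>, so the head of
  \<open>x\<close> puts no condition on the new letter.\<close>

lemma horadam_strings_ConsI:
  assumes "x \<in> horadam_strings a b n" "k < a"
  shows "k # x \<in> horadam_strings a b (Suc n)"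
  using assms by (fastforce simp: horadam_strings_def nth_Cons split: nat.splits)

lemma horadam_strings_Cons_ConsI:
  assumes "y \<in> horadam_strings a b n" "0 < a" "a \<le> l" "l < a + b"
  shows "0 # l # y \<in> horadam_strings a b (Suc (Suc n))"
  using assms by (fastforce simp: horadam_strings_def nth_Cons split: nat.splits)

text \<open>The case split is on the second letter. If it is below \<open>a\<close>, the first
  letter can be removed without depriving any large letter of its preceding 0; otherwise the first
  letter is that 0, and the two are removed together.\<close>

lemma horadam_strings_Suc_SucE:
  assumes x: "x \<in> horadam_strings a b (Suc (Suc n))" and "0 < a"
  obtains k y where "x = k # y" "k < a" "y \<in> horadam_strings a b (Suc n)"
  | l y where "x = 0 # l # y" "a \<le> l" "l < a + b" "y \<in> horadam_strings a b n"
proof -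
  obtain k l y where kly: "x = k # l # y" and len: "length y = n"
    using x by (auto simp: horadam_strings_def length_Suc_conv)
  have less: "\<And>i. i < Suc (Suc n) \<Longrightarrow> (k # l # y) ! i < a + b"
    and prev: "\<And>i. i < Suc (Suc n) \<Longrightarrow> a \<le> (k # l # y) ! i \<Longrightarrow> 0 < i \<and> (k # l # y) ! (i - 1) = 0"
    using x kly by (auto simp: horadam_strings_def)
  \<comment> \<open>Position 0 has no predecessor, so the requirement \<open>0 < i\<close> excludes
    a large letter there.\<close>
  have k: "k < a"
    using prev[of 0] by force
  show thesis
  proof (cases "l < a")
    case True
    have "(l # y) ! i < a + b" if "i < Suc n" for i
      using less[of "Suc i"] that by simp
    moreover have "0 < i \<and> (l # y) ! (i - 1) = 0" if "i < Suc n" "a \<le> (l # y) ! i" for i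
      using prev[of "Suc i"] that True by (cases i) auto
    ultimately have "l # y \<in> horadam_strings a b (Suc n)"
      using len by (simp add: horadam_strings_def)
    with k kly that(1) show thesis by blast
  next
    case False
    have "y ! i < a + b" if "i < n" for i
      using less[of "Suc (Suc i)"] that by simp
    \<comment> \<open>At \<open>i = 0\<close> a large head of \<open>y\<close> would force its
      predecessor \<open>l\<close> to be 0, contradicting \<open>l \<ge> a > 0\<close>.\<close>
    moreover have "0 < i \<and> y ! (i - 1) = 0" if "i < n" "a \<le> y ! i" for i
      using prev[of "Suc (Suc i)"] that False \<open>0 < a\<close> by (cases i) auto
    ultimately have "y \<in> horadam_strings a b n"
      using len by (simp add: horadam_strings_def)
    moreover have "k = 0" "l < a + b"
      using prev[of 1] less[of 1] False by auto
    ultimately show thesis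
      using False kly that(2) by simp
  qed
qed

lemma horadam_strings_Suc_Suc:
  assumes "0 < a"
  shows "horadam_strings a b (Suc (Suc n)) =
    (\<Union>k\<in>{0..<a}. (\<lambda>\<alpha>. k # \<alpha>) ` horadam_strings a b (Suc n)) \<union>
    (\<Union>l\<in>{a..<a + b}. (\<lambda>\<beta>. 0 # l # \<beta>) ` horadam_strings a b n)" (is "_ = ?R")
proof
  show "horadam_strings a b (Suc (Suc n)) \<subseteq> ?R"
  proof
    fix x assume "x \<in> horadam_strings a b (Suc (Suc n))"
    then show "x \<in> ?R"
      using assms by (cases rule: horadam_strings_Suc_SucE) auto
  qed
  show "?R \<subseteq> horadam_strings a b (Suc (Suc n))"
    using assms by (auto intro: horadam_strings_ConsI horadam_strings_Cons_ConsI)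
qed

text \<open>This separates the two families of parts: a string \<open>0 # l # y\<close> with
  \<open>l \<ge> a\<close> cannot be 0 followed by a Horadam string.\<close>

lemma horadam_strings_hd_less:
  "l # y \<in> horadam_strings a b n \<Longrightarrow> l < a"
  by (fastforce simp: horadam_strings_def)

section \<open>Isometric copies of smaller cubes and of their products with paths\<close>

text \<open>An isometry is injective because distance 0 means equality, and it respects adjacency
  because adjacency means distance 1. Prefixing fixed letters is the intended
  \<open>g\<close>.\<close>

lemma digraph_iso_isometric_copy:
  assumes g: "\<And>x. x \<in> horadam_strings a b r \<Longrightarrow> g x \<in> horadam_strings a b n"
    and dist: "\<And>x y. list_dist (g x) (g y) = list_dist x y"
  shows "digraph_iso (with_proj (horadam_cube a b n) \<restriction> g ` horadam_strings a b r)
    (with_proj (horadam_cube a b r))"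
proof (rule digraph_iso_induced_subgraphI[OF pair_graph_horadam_cube pair_graph_horadam_cube])
  have "inj_on g (horadam_strings a b r)"
    by (rule inj_onI) (metis dist length_horadam_strings list_dist_eq_0_iff)
  then show "bij_betw g (pverts (horadam_cube a b r)) (g ` horadam_strings a b r)"
    by (simp add: pverts_horadam_cube bij_betw_def)
qed (use g in \<open>auto simp: pverts_horadam_cube parcs_horadam_cube_iff dist\<close>)

text \<open>The maps \<open>g i\<close> are the layers of the product, with \<open>i\<close> as the
  path coordinate: \<open>dist\<close> makes the distance in the image the sum of the distances in
  the two factors.\<close>

lemma digraph_iso_path_product:
  assumes g: "\<And>i x. i < m \<Longrightarrow> x \<in> horadam_strings a b r \<Longrightarrow> g i x \<in> horadam_strings a b n"
    and dist: "\<And>i j x y. list_dist (g i x) (g j y) = \<bar>int i - int j\<bar> + list_dist x y"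
  shows "digraph_iso (with_proj (horadam_cube a b n) \<restriction> (\<Union>i<m. g i ` horadam_strings a b r))
    (with_proj (path_graph m \<box> horadam_cube a b r))"
proof (rule digraph_iso_induced_subgraphI[where g = "\<lambda>(i, x). g i x",
      OF pair_graph_horadam_cube
        pair_graph_cartesian_product[OF pair_graph_path_graph pair_graph_horadam_cube]])
  have verts: "pverts (path_graph m \<box> horadam_cube a b r) = {..<m} \<times> horadam_strings a b r"
    by (simp add: cartesian_product_def path_graph_def pverts_horadam_cube)
  \<comment> \<open>The distance from a list to itself is 0, so both nonnegative summands in
    \<open>dist\<close> vanish.\<close>
  have "i = j \<and> x = y"
    if "g i x = g j y" "x \<in> horadam_strings a b r" "y \<in> horadam_strings a b r" for i j x y
  proof -
    have "\<bar>int i - int j\<bar> + list_dist x y = list_dist (g j y) (g j y)"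
      using that(1) dist by metis
    then have "\<bar>int i - int j\<bar> = 0" "list_dist x y = 0"
      using list_dist_nonneg[of x y] list_dist_eq_0_iff[of "g j y" "g j y"] by simp_all
    then show ?thesis
      using that(2,3) by (simp add: length_horadam_strings list_dist_eq_0_iff)
  qed
  then have "inj_on (\<lambda>(i, x). g i x) ({..<m} \<times> horadam_strings a b r)"
    by (auto simp: inj_on_def)
  then show "bij_betw (\<lambda>(i, x). g i x) (pverts (path_graph m \<box> horadam_cube a b r))
      (\<Union>i<m. g i ` horadam_strings a b r)"
    by (auto simp: verts bij_betw_def)
  fix u v
  assume "u \<in> pverts (path_graph m \<box> horadam_cube a b r)"
    and "v \<in> pverts (path_graph m \<box> horadam_cube a b r)"
  then obtain i x j y where uv: "u = (i, x)" "v = (j, y)" "i < m" "j < m"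
    and xy: "x \<in> horadam_strings a b r" "y \<in> horadam_strings a b r"
    by (auto simp: verts)
  have "list_dist x y = 0 \<longleftrightarrow> x = y"
    using xy by (simp add: length_horadam_strings list_dist_eq_0_iff)
  moreover have "p + q = 1 \<longleftrightarrow> p = 0 \<and> q = 1 \<or> q = 0 \<and> p = 1" if "p \<ge> 0" "q \<ge> 0" for p q :: int
    using that by arith
  ultimately have "\<bar>int i - int j\<bar> + list_dist x y = 1 \<longleftrightarrow>
      i = j \<and> list_dist x y = 1 \<or> x = y \<and> \<bar>int i - int j\<bar> = 1"
    using list_dist_nonneg[of x y] by simp
  \<comment> \<open>For natural numbers, \<open>j = Suc i \<or> i = Suc j\<close> is the same as
    absolute difference 1.\<close>
  moreover have "(u, v) \<in> parcs (path_graph m \<box> horadam_cube a b r) \<longleftrightarrow>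
      i = j \<and> list_dist x y = 1 \<or> x = y \<and> \<bar>int i - int j\<bar> = 1"
    using uv xy
    by (auto simp: cartesian_product_def parcs_horadam_cube_iff pverts_horadam_cube path_graph_def)
  ultimately show "((case u of (i, x) \<Rightarrow> g i x), (case v of (i, x) \<Rightarrow> g i x)) \<in>
      parcs (horadam_cube a b n) \<longleftrightarrow> (u, v) \<in> parcs (path_graph m \<box> horadam_cube a b r)"
    using uv xy g by (simp add: parcs_horadam_cube_iff dist)
qed

section \<open>Assembling the fine and the coarse partition of the Horadam cube\<close>

theorem theorem1:
  fixes a b n :: nat
  assumes "a \<ge> 1" and "b \<ge> 1" and "n \<ge> 2"
  defines "A \<equiv> \<lambda>k. (\<lambda>\<alpha>. k # \<alpha>) ` horadam_strings a b (n - 1)"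
    and "B \<equiv> \<lambda>l. (\<lambda>\<beta>. 0 # l # \<beta>) ` horadam_strings a b (n - 2)"
  shows "pverts (horadam_cube a b n) = (\<Union>k\<in>{0..<a}. A k) \<union> (\<Union>l\<in>{a..<a + b}. B l)
    \<and> disjoint_family_on A {0..<a}
    \<and> disjoint_family_on B {a..<a + b}
    \<and> (\<Union>k\<in>{0..<a}. A k) \<inter> (\<Union>l\<in>{a..<a + b}. B l) = {}
    \<and> (\<forall>k\<in>{0..<a}. digraph_iso (with_proj (horadam_cube a b n) \<restriction> A k)
          (with_proj (horadam_cube a b (n - 1))))
    \<and> (\<forall>l\<in>{a..<a + b}. digraph_iso (with_proj (horadam_cube a b n) \<restriction> B l)
          (with_proj (horadam_cube a b (n - 2))))
    \<and> digraph_iso (with_proj (horadam_cube a b n) \<restriction> (\<Union>k\<in>{0..<a}. A k))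
          (with_proj (path_graph a \<box> horadam_cube a b (n - 1)))
    \<and> digraph_iso (with_proj (horadam_cube a b n) \<restriction> (\<Union>l\<in>{a..<a + b}. B l))
          (with_proj (path_graph b \<box> horadam_cube a b (n - 2)))
    \<and> decomposes_into (horadam_cube a b n)
          (replicate a (horadam_cube a b (n - 1)) @ replicate b (horadam_cube a b (n - 2)))
    \<and> decomposes_into (horadam_cube a b n)
          [path_graph a \<box> horadam_cube a b (n - 1), path_graph b \<box> horadam_cube a b (n - 2)]"
proof -
  obtain r where r: "n = Suc (Suc r)"
    using \<open>n \<ge> 2\<close> by (metis add_2_eq_Suc le_Suc_ex)
  let ?G = "horadam_cube a b n" and ?H1 = "horadam_cube a b (n - 1)"
    and ?H2 = "horadam_cube a b (n - 2)"
  let ?VA = "\<Union>k\<in>{0..<a}. A k" and ?VB = "\<Union>l\<in>{a..<a + b}. B l"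
  have verts: "pverts ?G = ?VA \<union> ?VB"
    using horadam_strings_Suc_Suc[of a b r] \<open>a \<ge> 1\<close> by (simp add: pverts_horadam_cube A_def B_def r)
  have disj_A: "disjoint_family_on A {0..<a}" and disj_B: "disjoint_family_on B {a..<a + b}"
    by (auto simp: disjoint_family_on_def A_def B_def)
  \<comment> \<open>A common element would give \<open>\<alpha> = l # \<beta>\<close> with
    \<open>l \<ge> a\<close>, a Horadam string with a large head.\<close>
  have disj_AB: "?VA \<inter> ?VB = {}"
    by (auto simp: A_def B_def dest: horadam_strings_hd_less)
  have iso_A: "digraph_iso (with_proj ?G \<restriction> A k) (with_proj ?H1)" if "k < a" for k
    unfolding A_def using that
    by (intro digraph_iso_isometric_copy) (auto simp: r list_dist_Cons intro: horadam_strings_ConsI)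
  have iso_B: "digraph_iso (with_proj ?G \<restriction> B l) (with_proj ?H2)" if "a \<le> l" "l < a + b" for l
    unfolding B_def using that \<open>a \<ge> 1\<close>
    by (intro digraph_iso_isometric_copy)
      (auto simp: r list_dist_Cons intro: horadam_strings_Cons_ConsI)
  \<comment> \<open>The first letter is itself the path coordinate.\<close>
  have iso_VA: "digraph_iso (with_proj ?G \<restriction> ?VA) (with_proj (path_graph a \<box> ?H1))"
    unfolding A_def atLeast0LessThan
    by (intro digraph_iso_path_product) (auto simp: r list_dist_Cons intro: horadam_strings_ConsI)
  \<comment> \<open>Writing \<open>l = a + i\<close> makes the path coordinate start at 0; the shift
    by \<open>a\<close> cancels in differences.\<close>
  have "?VB = (\<Union>i<b. (\<lambda>\<beta>. 0 # (a + i) # \<beta>) ` horadam_strings a b (n - 2))"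
  proof -
    have "{a..<a + b} = (+) a ` {..<b}"
      by (simp add: lessThan_atLeast0 add.commute)
    then show ?thesis by (simp add: B_def)
  qed
  moreover have "digraph_iso
      (with_proj ?G \<restriction> (\<Union>i<b. (\<lambda>\<beta>. 0 # (a + i) # \<beta>) ` horadam_strings a b (n - 2)))
      (with_proj (path_graph b \<box> ?H2))"
    using \<open>a \<ge> 1\<close>
    by (intro digraph_iso_path_product)
      (auto simp: r list_dist_Cons intro: horadam_strings_Cons_ConsI)
  ultimately have iso_VB: "digraph_iso (with_proj ?G \<restriction> ?VB) (with_proj (path_graph b \<box> ?H2))"
    by simp
  have fine: "decomposes_into ?G (replicate a ?H1 @ replicate b ?H2)"
  proof -
    \<comment> \<open>The free letter is used as the index: the letters \<open>0, ..., a - 1\<close>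
      and \<open>a, ..., a + b - 1\<close> match exactly the positions of the two blocks in the list
      of graphs.\<close>
    define V where "V i = (if i < a then A i else B i)" for i
    have "disjoint_family_on V {..<a + b}"
      using disj_A disj_B disj_AB unfolding disjoint_family_on_def V_def
      by (auto simp: disjoint_iff) (metis atLeastLessThan_iff zero_le not_less)+
    moreover have "pverts ?G = (\<Union>i<a + b. V i)"
    proof -
      have "?VA = (\<Union>i\<in>{0..<a}. V i)" "?VB = (\<Union>i\<in>{a..<a + b}. V i)"
        by (simp_all add: V_def)
      moreover have "{..<a + b} = {0..<a} \<union> {a..<a + b}" by auto
      ultimately show ?thesis by (simp only: verts UN_Un)
    qed
    moreover have "digraph_iso (with_proj ?G \<restriction> V i)
        (with_proj ((replicate a ?H1 @ replicate b ?H2) ! i))" if "i < a + b" for i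
      using that iso_A iso_B by (simp add: V_def nth_append)
    ultimately show ?thesis
      unfolding decomposes_into_def by (intro exI[of _ V]) simp
  qed
  have coarse: "decomposes_into ?G [path_graph a \<box> ?H1, path_graph b \<box> ?H2]"
    unfolding decomposes_into_def
    using verts disj_AB iso_VA iso_VB
    by (intro exI[of _ "\<lambda>i. if i = 0 then ?VA else ?VB"])
      (auto simp: disjoint_family_on_def less_2_cases_iff lessThan_Suc numeral_2_eq_2)
  show ?thesis
    using verts disj_A disj_B disj_AB iso_A iso_B iso_VA iso_VB fine coarse by simp
qed

end
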